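(* Let $\mathcal{H}$ be a real Hilbert space, let $A\colon\mathcal{H}\to 2^{\mathcal{H}}$ be maximally monotone, let $\mu>0$, and let $B\colon\mathcal{H}\to\mathcal{H}$ be monotone and $\mu$-Lipschitzian. Assume that $\operatorname{zer}(A+B)\neq\varnothing$. Let $\gamma\in\,]0,+\infty[$, let $x_0,x_{-1}\in\mathcal{H}$ be arbitrary, and let $(x_n)_{n\in\mathbb{N}}$ and $(y_n)_{n\in\mathbb{N}}$ be generated by $$(\forall n\in\mathbb{N})\qquad y_n=2x_n-x_{n-1},\qquad x_{n+1}=J_{\gamma A}(x_n-\gamma By_n).$$ Then the following hold. (i) Suppose that $B$ is $\beta$-cocoercive for some $\beta\in\,]0,+\infty[$ and that $\gamma\in\,]0,\beta(1-\epsilon)/2]$ for some $\epsilon\in\,]0,1[$. Then there exists $\overline{x}\in\operatorname{zer}(A+B)$ such that $x_n$ converges weakly to $\overline{x}$. (ii) Suppose that $\gamma\in\,]0,(\sqrt{2}-1)/\mu[$. Then there exists $\overline{x}\in\operatorname{zer}(A+B)$ such that $x_n$ converges weakly to $\overline{x}$.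
   Context: $\mathbb{N}=\{0,1,2,\dots\}$. The inner product and norm of $\mathcal{H}$ are $\langle\cdot\mid\cdot\rangle$ and $\|\cdot\|$. A set-valued operator $A\colon\mathcal{H}\to 2^{\mathcal{H}}$ has graph $\operatorname{gra}(A)=\{(x,u)\in\mathcal{H}\times\mathcal{H}: u\in Ax\}$. It is monotone if $\langle x-y\mid u-v\rangle\geq 0$ for all $(x,u),(y,v)\in\operatorname{gra}(A)$, and maximally monotone if it is monotone and there is no monotone operator whose graph properly contains $\operatorname{gra}(A)$. The zero set is $\operatorname{zer}(A)=\{x\in\mathcal{H}: 0\in Ax\}$. The resolvent of $A$ is $J_A=(\operatorname{Id}+A)^{-1}$, which is single-valued and defined on all of $\mathcal{H}$ when $A$ is maximally monotone; thus $J_{\gamma A}=(\operatorname{Id}+\gamma A)^{-1}$. A single-valued operator $B\colon\mathcal{H}\to\mathcal{H}$ is $\mu$-Lipschitzian if $\|Bx-By\|\leq\mu\|x-y\|$ for all $x,y\in\mathcal{H}$, and $\beta$-cocoercive if $\langle x-y\mid Bx-By\rangle\geq\beta\|Bx-By\|^2$ for all $x,y\in\mathcal{H}$. *)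

theory Defs
  imports "HOL-Analysis.Analysis"
begin

type_synonym 'a setop = "'a \<Rightarrow> 'a set"

definition gra :: "'a setop \<Rightarrow> ('a \<times> 'a) set" where
  "gra A = {(x, u). u \<in> A x}"

(* The set-valued operator with which a single-valued operator is identified. *)
definition setop_of :: "('a \<Rightarrow> 'a) \<Rightarrow> 'a setop" where
  "setop_of B = (\<lambda>x. {B x})"

definition setop_add :: "'a::plus setop \<Rightarrow> 'a setop \<Rightarrow> 'a setop" where
  "setop_add A B = (\<lambda>x. {u + v | u v. u \<in> A x \<and> v \<in> B x})"

definition setop_scale :: "real \<Rightarrow> 'a::real_vector setop \<Rightarrow> 'a setop" where
  "setop_scale c A = (\<lambda>x. (\<lambda>u. c *\<^sub>R u) ` A x)"

definition setop_inverse :: "'a setop \<Rightarrow> 'a setop" where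
  "setop_inverse A = (\<lambda>u. {x. u \<in> A x})"

definition zer :: "'a::zero setop \<Rightarrow> 'a set" where
  "zer A = {x. 0 \<in> A x}"

(* Set-valued; its values are singletons when A is maximally monotone. *)
definition resolvent :: "'a::real_vector setop \<Rightarrow> 'a setop" where
  "resolvent A = setop_inverse (setop_add (setop_of id) A)"

definition monotone_op :: "'a::real_inner setop \<Rightarrow> bool" where
  "monotone_op A \<longleftrightarrow>
    (\<forall>(x, u) \<in> gra A. \<forall>(y, v) \<in> gra A. inner (x - y) (u - v) \<ge> 0)"

definition maximally_monotone :: "'a::real_inner setop \<Rightarrow> bool" where
  "maximally_monotone A \<longleftrightarrow>
    monotone_op A \<and> \<not> (\<exists>A'. monotone_op A' \<and> gra A \<subset> gra A')"

definition cocoercive :: "real \<Rightarrow> ('a::real_inner \<Rightarrow> 'a) \<Rightarrow> bool" where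
  "cocoercive \<beta> B \<longleftrightarrow>
    (\<forall>x y. inner (x - y) (B x - B y) \<ge> \<beta> * (norm (B x - B y))\<^sup>2)"

(* Convergence in the weak topology of a Hilbert space, i.e. the initial topology
   of the functionals x \<mapsto> inner x u. *)
definition weakly_converges :: "(nat \<Rightarrow> 'a::real_inner) \<Rightarrow> 'a \<Rightarrow> bool" where
  "weakly_converges x l \<longleftrightarrow> (\<forall>u. (\<lambda>n. inner (x n) u) \<longlonglongrightarrow> inner l u)"

end

theory Submission
  imports Defs
begin

text \<open>
  Fix a zero p of A + B and write D(n) = x(n) - x(n-1), E(n) = x(n) - y(n-1) and c(n) = a(n) + B p,
  where a(n) is the element of A x(n) produced by the resolvent step. In the cocoercive case
  |x(n) - p|^2 + (\<gamma>/\<beta>) |D(n)|^2 is decreasing; in the Lipschitz case so is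
  |x(n) - p|^2 - 2 \<gamma> <D(n), c(n-1)> + \<gamma> \<mu> |E(n)|^2, which is bounded below by |x(n) - p|^2 / 2.
  Each step loses a multiple of the squared norm of an increment, so |x(n) - p| converges and D(n)
  tends to 0. Then a(n) + B x(n) tends to 0, and since the graph of A + B is weak-strong closed, weak
  cluster points are zeros; Opial's argument shows that there is only one. Cluster points are taken
  along filters finer than the sequential one: Tychonoff's theorem and the Riesz representation then
  give weak compactness without a separability assumption.
\<close>

section \<open>Weak limits along filters and weak compactness of bounded families\<close>

definition weak_tendsto :: "('n \<Rightarrow> 'a::real_inner) \<Rightarrow> 'a \<Rightarrow> 'n filter \<Rightarrow> bool" where
  "weak_tendsto f l F \<longleftrightarrow> (\<forall>u. ((\<lambda>n. inner (f n) u) \<longlongrightarrow> inner l u) F)"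

lemma weak_tendsto_inner:
  "weak_tendsto f l F \<Longrightarrow> ((\<lambda>n. inner (f n) u) \<longlongrightarrow> inner l u) F"
  by (simp add: weak_tendsto_def)

lemma weak_tendsto_mono:
  "weak_tendsto f l F \<Longrightarrow> G \<le> F \<Longrightarrow> weak_tendsto f l G"
  unfolding weak_tendsto_def by (blast intro: tendsto_mono)

lemma weak_tendsto_add_null:
  assumes "weak_tendsto f l F" and "((\<lambda>n. g n - f n) \<longlongrightarrow> 0) F"
  shows "weak_tendsto g l F"
  unfolding weak_tendsto_def
proof
  fix u
  have "((\<lambda>n. inner (f n) u + inner (g n - f n) u) \<longlongrightarrow> inner l u + inner 0 u) F"
    by (intro tendsto_add weak_tendsto_inner tendsto_inner tendsto_const assms)
  then show "((\<lambda>n. inner (g n) u) \<longlongrightarrow> inner l u) F"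
    by (simp add: inner_diff_left)
qed

text \<open>Eventually \<open>f\<close> stays in a product of compact intervals, compact by
  Tychonoff, so it has a cluster point in the topology of pointwise convergence.\<close>

lemma pointwise_bounded_cluster_point:
  fixes f :: "'n \<Rightarrow> 'a \<Rightarrow> real"
  assumes "F \<noteq> bot" and bd: "\<forall>\<^sub>F n in F. \<forall>u. \<bar>f n u\<bar> \<le> C u"
  obtains G L where "G \<le> F" "G \<noteq> bot" "\<forall>u. ((\<lambda>n. f n u) \<longlongrightarrow> L u) G"
proof -
  define K where "K = PiE UNIV (\<lambda>u. {- C u..C u})"
  have "compactin (product_topology (\<lambda>i. euclidean) UNIV) K"
    unfolding K_def by (subst compactin_PiE) auto
  then have "compact K"
    by (simp add: euclidean_product_topology)
  moreover have "filtermap f F \<noteq> bot"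
    using assms(1) by (simp add: filtermap_bot_iff)
  moreover have "\<forall>\<^sub>F g in filtermap f F. g \<in> K"
    unfolding eventually_filtermap using bd
    by eventually_elim (auto simp: K_def abs_le_iff minus_le_iff)
  ultimately obtain L where "inf (nhds L) (filtermap f F) \<noteq> bot"
    unfolding compact_filter by blast
  \<comment> \<open>The cluster point becomes a limit along \<open>G\<close>, which adds to
    \<open>F\<close> the preimages of the neighbourhoods of \<open>L\<close>; clustering at
    \<open>L\<close> is what makes \<open>G\<close> proper.\<close>
  define G where "G = inf F (filtercomap f (nhds L))"
  have "G \<noteq> bot"
  proof
    assume "G = bot"
    then have "eventually (\<lambda>_. False) G" by simp
    then obtain P Q where P: "eventually P F" and Q: "eventually Q (nhds L)"
      and PQ: "\<And>n. P n \<Longrightarrow> Q (f n) \<Longrightarrow> False"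
      unfolding G_def eventually_inf eventually_filtercomap by blast
    have "eventually (\<lambda>g. \<not> Q g) (filtermap f F)"
      unfolding eventually_filtermap using P by eventually_elim (use PQ in blast)
    with Q have "eventually (\<lambda>_. False) (inf (nhds L) (filtermap f F))"
      unfolding eventually_inf by blast
    with \<open>inf (nhds L) (filtermap f F) \<noteq> bot\<close> show False
      by (simp add: trivial_limit_def)
  qed
  moreover have "(f \<longlongrightarrow> L) G"
    unfolding G_def filterlim_def
    by (meson filtermap_filtercomap filtermap_mono inf_le2 order_trans)
  then have "((\<lambda>n. f n u) \<longlongrightarrow> L u) G" for u
    by (rule continuous_on_tendsto_compose[OF continuous_on_product_coordinates]) auto
  ultimately show ?thesis
    using that[of G L] by (simp add: G_def)
qed

lemma riesz_representation:
  fixes L :: "'a::{real_inner, complete_space} \<Rightarrow> real"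
  assumes "bounded_linear L"
  obtains l where "\<And>u. L u = inner l u"
proof -
  interpret bounded_linear L by fact
  obtain M where M: "\<And>u. \<bar>L u\<bar> \<le> norm u * M"
    using bounded by auto
  \<comment> \<open>The representing vector is the minimiser of this functional.\<close>
  define q where "q u = (norm u)\<^sup>2 - 2 * L u" for u
  have "- M\<^sup>2 \<le> q u" for u
  proof -
    have "0 \<le> (norm u - M)\<^sup>2" by simp
    then show ?thesis
      using M[of u] by (auto simp: q_def power2_eq_square algebra_simps)
  qed
  then have bdd: "bdd_below (range q)" by (rule bdd_belowI2)
  define m where "m = Inf (range q)"
  have m_le: "m \<le> q u" for u
    unfolding m_def using bdd by (auto intro: cInf_lower)
  have "\<exists>u. q u < m + inverse (Suc n)" for n
    using cInf_lessD[of "range q" "m + inverse (Suc n)"] by (auto simp: m_def)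
  then obtain p where p: "\<And>n. q (p n) < m + inverse (Suc n)" by metis
  \<comment> \<open>By the parallelogram law, two near-minimisers of \<open>q\<close> are close,
    since \<open>q\<close> at their midpoint is still at least \<open>m\<close>.\<close>
  have diff: "(norm (p i - p j))\<^sup>2 \<le> 2 * inverse (Suc i) + 2 * inverse (Suc j)" for i j
  proof -
    have "(norm (p i - p j))\<^sup>2 = 2 * q (p i) + 2 * q (p j) - 4 * q ((1/2) *\<^sub>R (p i + p j))"
      unfolding q_def scaleR add power2_norm_eq_inner
      by (simp add: inner_simps inner_commute field_simps)
    with p[of i] p[of j] m_le[of "(1/2) *\<^sub>R (p i + p j)"] show ?thesis by linarith
  qed
  have "Cauchy p"
  proof (rule metric_CauchyI)
    fix e :: real assume "e > 0"
    then obtain N where N: "inverse (real (Suc N)) < e\<^sup>2 / 4"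
      using reals_Archimedean[of "e\<^sup>2 / 4"] by auto
    have "dist (p i) (p j) < e" if "i \<ge> N" "j \<ge> N" for i j
    proof -
      have "inverse (real (Suc i)) \<le> inverse (real (Suc N))" "inverse (real (Suc j)) \<le> inverse (real (Suc N))"
        using that by (auto intro!: le_imp_inverse_le)
      with diff[of i j] N have "(norm (p i - p j))\<^sup>2 < e\<^sup>2" by linarith
      then show ?thesis
        using \<open>e > 0\<close> by (metis dist_norm less_eq_real_def power2_less_imp_less)
    qed
    then show "\<exists>N. \<forall>i\<ge>N. \<forall>j\<ge>N. dist (p i) (p j) < e" by blast
  qed
  then obtain l where l: "p \<longlonglongrightarrow> l"
    using Cauchy_convergent convergent_def by blast
  have "(\<lambda>n. q (p n)) \<longlonglongrightarrow> q l"
    unfolding q_def by (intro tendsto_intros tendsto l)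
  moreover have "(\<lambda>n. m + inverse (real (Suc n))) \<longlonglongrightarrow> m"
    using tendsto_add[OF tendsto_const LIMSEQ_inverse_real_of_nat, of m] by simp
  ultimately have q_l: "q l \<le> m"
    by (rule LIMSEQ_le) (use p less_imp_le in blast)
  have "L u = inner l u" for u
  proof (cases "u = 0")
    case False
    \<comment> \<open>This \<open>t\<close> minimises the quadratic
      \<open>q (l + t *\<^sub>R u) - q l\<close>, whose minimum is minus the squared residual over
      \<open>inner u u\<close>; minimality of \<open>l\<close> forces the residual to
      vanish.\<close>
    define t where "t = (L u - inner l u) / inner u u"
    have "q l \<le> q (l + t *\<^sub>R u)" using q_l m_le by (rule order_trans)
    then have "0 \<le> t\<^sup>2 * inner u u - 2 * t * (L u - inner l u)"
      unfolding q_def add scaleR power2_norm_eq_inner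
      by (simp add: inner_simps inner_commute[of u l] power2_eq_square algebra_simps)
    also have "L u - inner l u = t * inner u u"
      using False by (simp add: t_def)
    finally have "t\<^sup>2 * inner u u \<le> 0"
      by (simp add: power2_eq_square algebra_simps)
    then show ?thesis
      using False by (auto simp: mult_le_0_iff t_def not_le[symmetric] dest: order_antisym)
  qed (simp add: zero)
  then show ?thesis by (rule that)
qed

text \<open>The functionals \<open>inner (f n)\<close> have a pointwise cluster point; it inherits
  linearity and the bound \<open>M\<close>, so Riesz turns it into a vector.\<close>

lemma bounded_weak_cluster_point:
  fixes f :: "'n \<Rightarrow> 'a::{real_inner, complete_space}"
  assumes "F \<noteq> bot" and bd: "\<forall>\<^sub>F n in F. norm (f n) \<le> M"
  obtains G l where "G \<le> F" "G \<noteq> bot" "weak_tendsto f l G"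
proof -
  have ptw: "\<forall>\<^sub>F n in F. \<forall>u. \<bar>inner (f n) u\<bar> \<le> norm u * M"
    using bd
  proof eventually_elim
    case (elim n)
    show ?case
    proof
      fix u
      have "\<bar>inner (f n) u\<bar> \<le> norm (f n) * norm u" by (rule Cauchy_Schwarz_ineq2)
      also have "\<dots> \<le> norm u * M"
        using elim by (subst mult.commute) (rule mult_left_mono, auto)
      finally show "\<bar>inner (f n) u\<bar> \<le> norm u * M" .
    qed
  qed
  obtain G L where G: "G \<le> F" "G \<noteq> bot"
    and "\<forall>u. ((\<lambda>n. inner (f n) u) \<longlongrightarrow> L u) G"
    by (rule pointwise_bounded_cluster_point[OF assms(1) ptw])
  then have L: "((\<lambda>n. inner (f n) u) \<longlongrightarrow> L u) G" for u by blast
  have bd': "\<forall>\<^sub>F n in G. \<forall>u. \<bar>inner (f n) u\<bar> \<le> norm u * M"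
    using G(1) ptw by (rule filter_leD)
  have "bounded_linear L"
  proof
    show "L (u + v) = L u + L v" for u v
      using tendsto_unique[OF G(2) L[of "u + v"]] tendsto_add[OF L[of u] L[of v]]
      by (simp add: inner_simps)
    show "L (r *\<^sub>R u) = r *\<^sub>R L u" for r u
      using tendsto_unique[OF G(2) L[of "r *\<^sub>R u"]] tendsto_mult_left[OF L[of u], of r]
      by simp
    have "norm (L u) \<le> norm u * M" for u
      by (rule tendsto_upperbound[OF tendsto_norm[OF L[of u]] _ G(2)])
        (use bd' in \<open>eventually_elim, simp\<close>)
    then show "\<exists>K. \<forall>u. norm (L u) \<le> norm u * K" by blast
  qed
  then obtain l where "\<And>u. L u = inner l u"
    by (rule riesz_representation) blast
  with L have "weak_tendsto f l G" by (simp add: weak_tendsto_def)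
  with G show ?thesis by (rule that)
qed

section \<open>Opial's lemma\<close>

text \<open>Expanding squares shows that \<open>inner (x n) (p - p')\<close> converges for any p and
  p' in \<open>S\<close>. If both are weak cluster points, \<open>p - p'\<close> is orthogonal to
  itself. Uniqueness together with weak compactness gives convergence.\<close>

lemma opial:
  fixes x :: "nat \<Rightarrow> 'a::{real_inner, complete_space}"
  assumes "S \<noteq> {}"
    and conv: "\<And>p. p \<in> S \<Longrightarrow> convergent (\<lambda>n. norm (x n - p))"
    and clus: "\<And>G p. G \<le> sequentially \<Longrightarrow> G \<noteq> bot \<Longrightarrow> weak_tendsto x p G \<Longrightarrow> p \<in> S"
  shows "\<exists>p\<in>S. weakly_converges x p"
proof -
  obtain s where "s \<in> S" using assms(1) by blast
  then have "Bseq (\<lambda>n. norm (x n - s))"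
    using conv convergent_imp_Bseq by blast
  then obtain K where "\<And>n. norm (x n - s) \<le> K"
    by (auto simp: Bseq_def)
  then have bd: "norm (x n) \<le> K + norm s" for n
    using norm_triangle_sub[of "x n" s] by (smt (verit))
  have subseq: "\<exists>G' l. G' \<le> G \<and> G' \<noteq> bot \<and> weak_tendsto x l G'" if "G \<noteq> bot" for G
    by (rule bounded_weak_cluster_point[OF that always_eventually, of x]) (use bd in blast)+
  obtain G p where G: "G \<le> sequentially" "G \<noteq> bot" and p: "weak_tendsto x p G"
    using subseq[of sequentially] by auto
  then have "p \<in> S" by (rule clus)
  have uniq: "p' = p" if G': "G' \<le> sequentially" "G' \<noteq> bot" and p': "weak_tendsto x p' G'" for G' p'
  proof -
    have "p' \<in> S" using that by (rule clus)
    obtain a b where a: "(\<lambda>n. norm (x n - p)) \<longlonglongrightarrow> a" and b: "(\<lambda>n. norm (x n - p')) \<longlonglongrightarrow> b"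
      using conv[OF \<open>p \<in> S\<close>] conv[OF \<open>p' \<in> S\<close>] by (auto simp: convergent_def)
    define k where "k = ((norm p)\<^sup>2 - (norm p')\<^sup>2 + b\<^sup>2 - a\<^sup>2) / 2"
    have "inner (x n) (p - p')
        = ((norm p)\<^sup>2 - (norm p')\<^sup>2 + (norm (x n - p'))\<^sup>2 - (norm (x n - p))\<^sup>2) / 2" for n
      unfolding power2_norm_eq_inner by (simp add: inner_simps inner_commute)
    then have lim: "(\<lambda>n. inner (x n) (p - p')) \<longlonglongrightarrow> k"
      unfolding k_def by (simp only:) (intro tendsto_intros a b, simp)
    have "inner p (p - p') = k"
      using G(2) weak_tendsto_inner[OF p] tendsto_mono[OF G(1) lim] by (rule tendsto_unique)
    moreover have "inner p' (p - p') = k"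
      using G'(2) weak_tendsto_inner[OF p'] tendsto_mono[OF G'(1) lim] by (rule tendsto_unique)
    ultimately have "inner (p - p') (p - p') = 0" by (simp add: inner_diff_left)
    then show ?thesis by simp
  qed
  have "(\<lambda>n. inner (x n) u) \<longlonglongrightarrow> inner p u" for u
  proof (rule ccontr)
    assume "\<not> ?thesis"
    then obtain e where "e > 0"
      and freq: "\<not> (\<forall>\<^sub>F n in sequentially. dist (inner (x n) u) (inner p u) < e)"
      by (auto simp: tendsto_iff)
    \<comment> \<open>\<open>H\<close> lives on the indices where the functional stays at distance
      at least e. A weak cluster point along it would again be \<open>p\<close>, which contradicts
      that distance.\<close>
    define H where "H = inf sequentially (principal {n. \<not> dist (inner (x n) u) (inner p u) < e})"
    have "H \<noteq> bot"
      using freq by (auto simp: H_def trivial_limit_def eventually_inf_principal)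
    then obtain G' p' where G': "G' \<le> H" "G' \<noteq> bot" and p': "weak_tendsto x p' G'"
      using subseq by blast
    have "G' \<le> sequentially" using G'(1) by (simp add: H_def)
    with G' p' uniq have "weak_tendsto x p G'" by blast
    then have "\<forall>\<^sub>F n in G'. dist (inner (x n) u) (inner p u) < e"
      using \<open>e > 0\<close> by (auto simp: weak_tendsto_def tendsto_iff)
    moreover have "\<forall>\<^sub>F n in G'. \<not> dist (inner (x n) u) (inner p u) < e"
      using G'(1) by (rule filter_leD) (simp add: H_def eventually_inf_principal)
    ultimately have "\<forall>\<^sub>F n in G'. False" by eventually_elim simp
    with G'(2) show False by (simp add: trivial_limit_def)
  qed
  with \<open>p \<in> S\<close> show ?thesis by (auto simp: weakly_converges_def)
qed

section \<open>Maximal monotonicity and weak-strong closedness\<close>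

text \<open>Adjoining \<open>(z, w)\<close> to the graph would keep it monotone, so maximality puts
  the pair in the graph already.\<close>

lemma maximally_monotone_memI:
  assumes "maximally_monotone A" and mono: "\<And>x u. u \<in> A x \<Longrightarrow> inner (z - x) (w - u) \<ge> 0"
  shows "w \<in> A z"
proof (rule ccontr)
  assume "w \<notin> A z"
  define A' where "A' = A(z := insert w (A z))"
  have "gra A' = insert (z, w) (gra A)" by (auto simp: A'_def gra_def split: if_splits)
  moreover have "inner (x - z) (u - w) \<ge> 0" if "u \<in> A x" for x u
    using mono[OF that] by (simp add: inner_simps)
  ultimately have "monotone_op A'"
    using assms by (auto simp: monotone_op_def maximally_monotone_def gra_def)
  moreover have "gra A \<subset> gra A'"
    using \<open>gra A' = _\<close> \<open>w \<notin> A z\<close> by (auto simp: gra_def)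
  ultimately show False
    using assms(1) by (auto simp: maximally_monotone_def)
qed

text \<open>Let \<open>b\<close> be a weak cluster point of \<open>B (p n)\<close>. Maximality of
  \<open>A\<close> yields \<open>- b \<in> A z\<close>; this new graph point then lets Minty's trick
  identify \<open>b\<close> with \<open>B z\<close>.\<close>

lemma maximally_monotone_add_lipschitz_demiclosed:
  fixes A :: "'a::{real_inner, complete_space} setop"
  assumes A: "maximally_monotone A"
    and B: "\<And>x y. inner (x - y) (B x - B y) \<ge> 0"
    and lip: "\<mu>-lipschitz_on UNIV B" and "\<mu> > 0"
    and "F \<noteq> bot"
    and v: "\<And>n. v n \<in> A (p n)"
    and null: "((\<lambda>n. v n + B (p n)) \<longlongrightarrow> 0) F"
    and bd: "\<And>n. norm (p n) \<le> M"
    and p: "weak_tendsto p z F"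
  shows "- B z \<in> A z"
proof -
  have Bp_bd: "norm (B (p n)) \<le> norm (B 0) + \<mu> * M" for n
  proof -
    have "norm (B (p n) - B 0) \<le> \<mu> * norm (p n)"
      using lipschitz_onD[OF lip, of "p n" 0] by (simp add: dist_norm)
    also have "\<dots> \<le> \<mu> * M" using bd \<open>\<mu> > 0\<close> by simp
    finally show ?thesis using norm_triangle_sub[of "B (p n)" "B 0"] by linarith
  qed
  obtain G b where G: "G \<le> F" "G \<noteq> bot" and b: "weak_tendsto (\<lambda>n. B (p n)) b G"
    by (rule bounded_weak_cluster_point[OF \<open>F \<noteq> bot\<close> always_eventually[OF allI[OF Bp_bd]]])
  note b_lim = weak_tendsto_inner[OF b]
  note p_lim = weak_tendsto_inner[OF weak_tendsto_mono[OF p G(1)]]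
  define w where "w n = v n + B (p n)" for n
  have w: "(w \<longlongrightarrow> 0) G" using null G(1) unfolding w_def by (rule tendsto_mono[rotated])
  have pw: "((\<lambda>n. inner (p n - u) (w n)) \<longlongrightarrow> 0) G" for u
  proof (rule Lim_null_comparison)
    show "\<forall>\<^sub>F n in G. norm (inner (p n - u) (w n)) \<le> (M + norm u) * norm (w n)"
    proof (rule always_eventually, rule allI)
      fix n
      have "norm (p n - u) \<le> M + norm u"
        using norm_triangle_ineq4[of "p n" u] bd[of n] by linarith
      then show "norm (inner (p n - u) (w n)) \<le> (M + norm u) * norm (w n)"
        using Cauchy_Schwarz_ineq2[of "p n - u" "w n"]
        by (smt (verit) mult_right_mono norm_ge_zero real_norm_def)
    qed
    show "((\<lambda>n. (M + norm u) * norm (w n)) \<longlongrightarrow> 0) G"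
      using tendsto_mult_right_zero[OF tendsto_norm_zero[OF w]] by simp
  qed
  have A_mono: "inner (p n - x) (w n - B (p n) - u) \<ge> 0" if "u \<in> A x" for n x u
    using A v[of n] that by (auto simp: maximally_monotone_def monotone_op_def gra_def w_def)
  \<comment> \<open>Maximality of A alone suffices: monotonicity of B gives lim inf \<open>inner (p n) (B (p n))\<close>
    at least \<open>inner z b\<close>, which is the only product of two weakly convergent sequences.\<close>
  have "- b \<in> A z"
  proof (rule maximally_monotone_memI[OF A])
    fix x u assume "u \<in> A x"
    have "0 \<le> inner (p n - x) (w n) - inner (p n) u + inner x u
        + inner (B (p n)) (x - z) - inner (p n) (B z) + inner z (B z)" for n
      using A_mono[OF \<open>u \<in> A x\<close>, of n] B[of "p n" z] by (simp add: inner_simps inner_commute)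
    moreover have "((\<lambda>n. inner (p n - x) (w n) - inner (p n) u + inner x u
        + inner (B (p n)) (x - z) - inner (p n) (B z) + inner z (B z))
        \<longlongrightarrow> 0 - inner z u + inner x u + inner b (x - z) - inner z (B z) + inner z (B z)) G"
      by (intro tendsto_intros pw p_lim b_lim)
    ultimately have "0 \<le> 0 - inner z u + inner x u + inner b (x - z) - inner z (B z) + inner z (B z)"
      using G(2) by (intro tendsto_lowerbound) auto
    then show "inner (z - x) (- b - u) \<ge> 0" by (simp add: inner_simps inner_commute)
  qed
  \<comment> \<open>Monotonicity of \<open>A\<close> against \<open>(z, - b)\<close> bounds
    \<open>inner (p n) (B (p n))\<close> from above. Adding monotonicity of \<open>B\<close> at
    \<open>q\<close> cancels that product, and every remaining term has a limit.\<close>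
  have minty: "0 \<le> inner (z - q) (b - B q)" for q
  proof -
    have "0 \<le> inner (p n - z) (w n) + inner (p n) b - inner z b
        + inner (B (p n)) (z - q) - inner (p n) (B q) + inner q (B q)" for n
      using A_mono[OF \<open>- b \<in> A z\<close>, of n] B[of "p n" q] by (simp add: inner_simps inner_commute)
    moreover have "((\<lambda>n. inner (p n - z) (w n) + inner (p n) b - inner z b
        + inner (B (p n)) (z - q) - inner (p n) (B q) + inner q (B q))
        \<longlongrightarrow> 0 + inner z b - inner z b + inner b (z - q) - inner z (B q) + inner q (B q)) G"
      by (intro tendsto_intros pw p_lim b_lim)
    ultimately have "0 \<le> 0 + inner z b - inner z b + inner b (z - q) - inner z (B q) + inner q (B q)"
      using G(2) by (intro tendsto_lowerbound) auto
    then show ?thesis by (simp add: inner_simps inner_commute)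
  qed
  define h where "h = b - B z"
  \<comment> \<open>Testing \<open>minty\<close> at \<open>z + t *\<^sub>R h\<close> gives
    \<open>(norm h)\<^sup>2 \<le> t * \<mu> * (norm h)\<^sup>2\<close>; with this \<open>t\<close>
    the factor is 1/2, so \<open>h = 0\<close>.\<close>
  define t where "t = 1 / (2 * \<mu>)"
  have "t > 0" using \<open>\<mu> > 0\<close> by (simp add: t_def)
  have "t * inner h (b - B (z + t *\<^sub>R h)) \<le> 0"
    using minty[of "z + t *\<^sub>R h"] by simp
  then have "inner h (b - B (z + t *\<^sub>R h)) \<le> 0"
    using \<open>t > 0\<close> by (simp add: mult_le_0_iff)
  then have "(norm h)\<^sup>2 \<le> inner h (B (z + t *\<^sub>R h) - B z)"
    unfolding power2_norm_eq_inner by (simp add: h_def inner_simps)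
  also have "\<dots> \<le> norm h * norm (B (z + t *\<^sub>R h) - B z)" by (rule norm_cauchy_schwarz)
  also have "\<dots> \<le> norm h * (\<mu> * norm (t *\<^sub>R h))"
    using lipschitz_onD[OF lip, of "z + t *\<^sub>R h" z] by (intro mult_left_mono) (auto simp: dist_norm)
  also have "\<dots> = (norm h)\<^sup>2 / 2"
    using \<open>\<mu> > 0\<close> by (simp add: t_def power2_eq_square)
  finally have "b = B z" by (simp add: h_def)
  with \<open>- b \<in> A z\<close> show ?thesis by simp
qed

section \<open>Decreasing potentials and elementary estimates\<close>

text \<open>A decreasing sequence bounded below converges, so its consecutive differences tend to 0,
  and these dominate \<open>\<kappa> * e n\<close>.\<close>

lemma summable_decrease:
  fixes V e :: "nat \<Rightarrow> real"
  assumes "\<And>n. 0 \<le> V n" "\<And>n. 0 \<le> e n" "\<kappa> > 0"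
    and decr: "\<And>n. V (Suc n) \<le> V n - \<kappa> * e n"
  shows "convergent V" and "e \<longlonglongrightarrow> 0"
proof -
  have "V (Suc n) \<le> V n" for n
    using decr[of n] mult_nonneg_nonneg[of \<kappa> "e n"] assms(2)[of n] \<open>\<kappa> > 0\<close> by linarith
  then have "decseq V" by (rule decseq_SucI)
  then obtain L where L: "V \<longlonglongrightarrow> L"
    using decseq_convergent assms(1) by blast
  then show "convergent V" by (rule convergentI)
  have "(\<lambda>n. (V n - V (Suc n)) / \<kappa>) \<longlonglongrightarrow> (L - L) / \<kappa>"
    using \<open>\<kappa> > 0\<close> by (intro tendsto_intros L LIMSEQ_Suc) auto
  moreover have "\<forall>\<^sub>F n in sequentially. norm (e n) \<le> (V n - V (Suc n)) / \<kappa>"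
  proof (rule always_eventually, rule allI)
    fix n
    show "norm (e n) \<le> (V n - V (Suc n)) / \<kappa>"
      using decr[of n] assms(2)[of n] \<open>\<kappa> > 0\<close> by (simp add: pos_le_divide_eq mult.commute)
  qed
  ultimately show "e \<longlonglongrightarrow> 0"
    by (auto intro: Lim_null_comparison)
qed

lemma power2_tendsto_0_imp_tendsto_0:
  fixes f :: "nat \<Rightarrow> 'a::real_normed_vector"
  assumes "(\<lambda>n. (norm (f n))\<^sup>2) \<longlonglongrightarrow> 0"
  shows "f \<longlonglongrightarrow> 0"
  using tendsto_real_sqrt[OF assms] by (simp add: tendsto_norm_zero_iff)

lemma convergent_power2_norm_imp:
  fixes f :: "nat \<Rightarrow> 'a::real_normed_vector"
  assumes "convergent (\<lambda>n. (norm (f n))\<^sup>2)"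
  shows "convergent (\<lambda>n. norm (f n))"
proof -
  obtain L where "(\<lambda>n. (norm (f n))\<^sup>2) \<longlonglongrightarrow> L"
    using assms by (auto simp: convergent_def)
  from tendsto_real_sqrt[OF this] show ?thesis by (auto intro: convergentI)
qed

text \<open>Young's inequality with a free weight; the weights chosen later produce the step-size
  bounds.\<close>

lemma two_mult_le_weighted:
  fixes a b w :: real
  assumes "w > 0"
  shows "2 * (a * b) \<le> w * a\<^sup>2 + b\<^sup>2 / w"
proof -
  have "0 \<le> (w * a - b)\<^sup>2 / w" using assms by simp
  also have "\<dots> = w * a\<^sup>2 + b\<^sup>2 / w - 2 * (a * b)"
    using assms by (simp add: power2_eq_square field_simps)
  finally show ?thesis by simp
qed

section \<open>The iteration and what both step-size regimes share\<close>

text \<open>\<open>step\<close> is the resolvent equation solved for the element of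
  \<open>A\<close>. Leaving \<open>y 0\<close> arbitrary absorbs the choice of the point preceding
  \<open>x 0\<close>.\<close>

locale reflected_forward_backward =
  fixes A :: "'h::{real_inner, complete_space} setop" and B :: "'h \<Rightarrow> 'h"
    and \<mu> \<gamma> :: real and x y :: "nat \<Rightarrow> 'h"
  assumes A: "maximally_monotone A"
    and B: "\<And>u v. inner (u - v) (B u - B v) \<ge> 0"
    and lip: "\<And>u v. norm (B u - B v) \<le> \<mu> * norm (u - v)"
    and pos: "\<mu> > 0" "\<gamma> > 0"
    and zer: "zer (setop_add A (setop_of B)) \<noteq> {}"
    and y_Suc: "\<And>n. y (Suc n) = 2 *\<^sub>R x (Suc n) - x n"
    and step: "\<And>n. (1 / \<gamma>) *\<^sub>R (x n - x (Suc n)) - B (y n) \<in> A (x (Suc n))"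
begin

definition a :: "nat \<Rightarrow> 'h" where
  "a n = (1 / \<gamma>) *\<^sub>R (x n - x (Suc n)) - B (y n)"

lemma a_mem: "a n \<in> A (x (Suc n))"
  using step by (simp add: a_def)

lemma scaleR_a: "\<gamma> *\<^sub>R a n = x n - x (Suc n) - \<gamma> *\<^sub>R B (y n)"
  using pos by (simp add: a_def scaleR_diff_right)

lemma A_mono: "u \<in> A p \<Longrightarrow> v \<in> A q \<Longrightarrow> inner (p - q) (u - v) \<ge> 0"
  using A by (auto simp: maximally_monotone_def monotone_op_def gra_def)

lemma mem_zer_iff: "p \<in> zer (setop_add A (setop_of B)) \<longleftrightarrow> - B p \<in> A p"
proof -
  have "0 = u + B p \<longleftrightarrow> u = - B p" for u
    by (metis add.commute add_eq_0_iff)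
  then show ?thesis by (simp add: zer_def setop_add_def setop_of_def)
qed

text \<open>Monotonicity of \<open>A\<close> between \<open>x (Suc n)\<close> and \<open>p\<close>,
  with the product of \<open>x (Suc n) - p\<close> and \<open>x n - x (Suc n)\<close> rewritten
  through three squared norms.\<close>

lemma step_inequality:
  assumes "- B p \<in> A p"
  shows "(norm (x (Suc n) - p))\<^sup>2 \<le> (norm (x n - p))\<^sup>2 - (norm (x (Suc n) - x n))\<^sup>2
    - 2 * \<gamma> * inner (x (Suc n) - p) (B (y n) - B p)"
proof -
  have "0 \<le> 2 * (\<gamma> * inner (x (Suc n) - p) (a n + B p))"
    using A_mono[OF a_mem assms] pos by simp
  also have "\<dots> = 2 * inner (x (Suc n) - p) (\<gamma> *\<^sub>R a n + \<gamma> *\<^sub>R B p)"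
    by (simp add: inner_simps algebra_simps)
  also have "\<dots> = (norm (x n - p))\<^sup>2 - (norm (x (Suc n) - p))\<^sup>2 - (norm (x (Suc n) - x n))\<^sup>2
    - 2 * \<gamma> * inner (x (Suc n) - p) (B (y n) - B p)"
    unfolding scaleR_a power2_norm_eq_inner by (simp add: inner_simps inner_commute algebra_simps)
  finally show ?thesis by simp
qed

text \<open>Reduces each regime to two facts: convergent distances to zeros and vanishing
  increments. The residual \<open>a n + B (x (Suc n))\<close> is controlled by increments, so
  demiclosedness supplies the cluster point condition of Opial's lemma.\<close>

lemma weakly_convergent:
  assumes conv: "\<And>p. - B p \<in> A p \<Longrightarrow> convergent (\<lambda>n. norm (x n - p))"
    and diff: "(\<lambda>n. x (Suc n) - x n) \<longlonglongrightarrow> 0"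
  shows "\<exists>p\<in>zer (setop_add A (setop_of B)). weakly_converges x p"
proof (rule opial[OF zer])
  show "convergent (\<lambda>n. norm (x n - p))" if "p \<in> zer (setop_add A (setop_of B))" for p
    using that conv by (simp add: mem_zer_iff)
  fix G p assume G: "G \<le> sequentially" "G \<noteq> bot" and p: "weak_tendsto x p G"
  obtain q where "- B q \<in> A q" using zer mem_zer_iff by blast
  then have "Bseq (\<lambda>n. norm (x n - q))"
    using conv convergent_imp_Bseq by blast
  then obtain K where K: "\<And>n. norm (x n - q) \<le> K"
    by (auto simp: Bseq_def)
  have bd: "norm (x (Suc n)) \<le> K + norm q" for n
    using norm_triangle_sub[of "x (Suc n)" q] K[of "Suc n"] by linarith
  have "(\<lambda>n. a n + B (x (Suc n))) \<longlonglongrightarrow> 0"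
  \<comment> \<open>Index 0 is skipped because \<open>y_Suc\<close> gives no formula for
    \<open>y 0\<close>.\<close>
  proof (rule LIMSEQ_offset[of _ 1], rule Lim_null_comparison)
    let ?b = "\<lambda>n. (1 / \<gamma>) * norm (x (Suc (Suc n)) - x (Suc n))
      + \<mu> * (norm (x (Suc (Suc n)) - x (Suc n)) + norm (x (Suc n) - x n))"
    show "\<forall>\<^sub>F n in sequentially. norm (a (n + 1) + B (x (Suc (n + 1)))) \<le> ?b n"
    proof (rule always_eventually, rule allI)
      fix n
      let ?v = "B (x (Suc (Suc n))) - B (y (Suc n))"
      have "a (n + 1) + B (x (Suc (n + 1))) = (1 / \<gamma>) *\<^sub>R (x (Suc n) - x (Suc (Suc n))) + ?v"
        by (simp add: a_def)
      then have "norm (a (n + 1) + B (x (Suc (n + 1))))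
          \<le> norm ((1 / \<gamma>) *\<^sub>R (x (Suc n) - x (Suc (Suc n)))) + norm ?v"
        using norm_triangle_ineq by metis
      moreover have "norm ((1 / \<gamma>) *\<^sub>R (x (Suc n) - x (Suc (Suc n))))
          = (1 / \<gamma>) * norm (x (Suc (Suc n)) - x (Suc n))"
        using pos by (simp add: norm_minus_commute)
      moreover have "norm ?v \<le> \<mu> * norm (x (Suc (Suc n)) - y (Suc n))"
        by (rule lip)
      moreover have "x (Suc (Suc n)) - y (Suc n)
          = (x (Suc (Suc n)) - x (Suc n)) - (x (Suc n) - x n)"
        by (simp add: y_Suc scaleR_2)
      then have "norm (x (Suc (Suc n)) - y (Suc n))
          \<le> norm (x (Suc (Suc n)) - x (Suc n)) + norm (x (Suc n) - x n)"
        using norm_triangle_ineq4 by metis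
      then have "\<mu> * norm (x (Suc (Suc n)) - y (Suc n))
          \<le> \<mu> * (norm (x (Suc (Suc n)) - x (Suc n)) + norm (x (Suc n) - x n))"
        using pos by (intro mult_left_mono) auto
      ultimately show "norm (a (n + 1) + B (x (Suc (n + 1)))) \<le> ?b n" by linarith
    qed
    have "(\<lambda>n. norm (x (Suc n) - x n)) \<longlonglongrightarrow> 0"
      using diff by (rule tendsto_norm_zero)
    from this LIMSEQ_Suc[OF this]
    have "?b \<longlonglongrightarrow> (1 / \<gamma>) * 0 + \<mu> * (0 + 0)"
      by (intro tendsto_intros)
    then show "?b \<longlonglongrightarrow> 0" by simp
  qed
  then have null: "((\<lambda>n. a n + B (x (Suc n))) \<longlongrightarrow> 0) G"
    using G(1) by (rule tendsto_mono[rotated])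
  \<comment> \<open>The elements \<open>a n\<close> sit at \<open>x (Suc n)\<close>, so the weak
    limit has to be carried to the shifted sequence; \<open>G\<close> itself need not be shift
    invariant.\<close>
  have p_Suc: "weak_tendsto (\<lambda>n. x (Suc n)) p G"
    using p tendsto_mono[OF G(1) diff] by (rule weak_tendsto_add_null)
  have "\<mu>-lipschitz_on UNIV B"
    using lip pos by (auto simp: lipschitz_on_def dist_norm)
  with A B have "- B p \<in> A p"
    by (rule maximally_monotone_add_lipschitz_demiclosed) (fact pos G(2) a_mem null bd p_Suc)+
  then show "p \<in> zer (setop_add A (setop_of B))" by (simp add: mem_zer_iff)
qed

section \<open>The cocoercive case\<close>

text \<open>Cocoercivity at \<open>y (Suc n)\<close> absorbs the \<open>b\<close> part of the cross
  term. The rest is at most c times the squares of the old and new increments: \<open>V\<close>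
  stores the old one, and the new one still leaves a loss of \<open>1 - 2 * c\<close>.\<close>

lemma cocoercive_fejer:
  assumes \<beta>: "\<beta> > 0" "cocoercive \<beta> B" "\<gamma> < \<beta> / 2" and p: "- B p \<in> A p"
  shows "convergent (\<lambda>n. norm (x n - p))" and "(\<lambda>n. x (Suc n) - x n) \<longlonglongrightarrow> 0"
proof -
  define c where "c = \<gamma> / \<beta>"
  define V where "V n = (norm (x (Suc n) - p))\<^sup>2 + c * (norm (x (Suc n) - x n))\<^sup>2" for n
  define e where "e n = (norm (x (Suc (Suc n)) - x (Suc n)))\<^sup>2" for n
  have c: "c > 0" "1 - 2 * c > 0" using \<beta> pos by (auto simp: c_def field_simps)
  have "V (Suc n) \<le> V n - (1 - 2 * c) * e n" for n
  proof -
    define D where "D = x (Suc n) - x n"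
    define D' where "D' = x (Suc (Suc n)) - x (Suc n)"
    define b where "b = B (y (Suc n)) - B p"
    have y: "x (Suc (Suc n)) - p = (D' - D) + (y (Suc n) - p)"
      by (simp add: D_def D'_def y_Suc scaleR_2)
    have "inner (y (Suc n) - p) b \<ge> \<beta> * (norm b)\<^sup>2"
      using \<beta>(2) by (simp add: cocoercive_def b_def)
    then have coco: "2 * \<gamma> * inner (y (Suc n) - p) b \<ge> 2 * \<gamma> * (\<beta> * (norm b)\<^sup>2)"
      using pos by simp
    have "- inner (D' - D) b \<le> norm (D' - D) * norm b"
      using Cauchy_Schwarz_ineq2[of "D' - D" b] by linarith
    \<comment> \<open>With weight \<open>1 / (2 * \<beta>)\<close> the term in \<open>b\<close>,
      once multiplied by \<gamma>, is exactly the gain in \<open>coco\<close>.\<close>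
    also have "2 * (norm (D' - D) * norm b)
        \<le> (1 / (2 * \<beta>)) * (norm (D' - D))\<^sup>2 + (norm b)\<^sup>2 / (1 / (2 * \<beta>))"
      using \<beta> by (intro two_mult_le_weighted) simp
    finally have "- 2 * inner (D' - D) b \<le> (norm (D' - D))\<^sup>2 / (2 * \<beta>) + 2 * \<beta> * (norm b)\<^sup>2"
      by (simp add: mult.commute)
    then have "\<gamma> * (- 2 * inner (D' - D) b)
        \<le> \<gamma> * ((norm (D' - D))\<^sup>2 / (2 * \<beta>) + 2 * \<beta> * (norm b)\<^sup>2)"
      using pos by (intro mult_left_mono) auto
    then have cross: "- 2 * \<gamma> * inner (D' - D) b
        \<le> c / 2 * (norm (D' - D))\<^sup>2 + 2 * \<gamma> * (\<beta> * (norm b)\<^sup>2)"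
      by (simp add: c_def algebra_simps)
    have "2 * (norm D')\<^sup>2 + 2 * (norm D)\<^sup>2 - (norm (D' - D))\<^sup>2 = (norm (D' + D))\<^sup>2"
      unfolding power2_norm_eq_inner by (simp add: inner_simps inner_commute)
    then have "(norm (D' - D))\<^sup>2 \<le> 2 * (norm D')\<^sup>2 + 2 * (norm D)\<^sup>2"
      using zero_le_power2[of "norm (D' + D)"] by linarith
    then have "c / 2 * (norm (D' - D))\<^sup>2 \<le> c / 2 * (2 * (norm D')\<^sup>2 + 2 * (norm D)\<^sup>2)"
      using c by (intro mult_left_mono) auto
    moreover have "(norm (x (Suc (Suc n)) - p))\<^sup>2 \<le> (norm (x (Suc n) - p))\<^sup>2 - (norm D')\<^sup>2
        - 2 * \<gamma> * inner (D' - D) b - 2 * \<gamma> * inner (y (Suc n) - p) b"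
      using step_inequality[OF p, of "Suc n"] unfolding y b_def[symmetric] D'_def[symmetric]
      by (simp add: inner_add_left algebra_simps)
    ultimately show ?thesis
      using coco cross unfolding V_def e_def D_def[symmetric] D'_def[symmetric]
      by (simp add: algebra_simps)
  qed
  moreover have "0 \<le> V n" "0 \<le> e n" for n
    using c by (simp_all add: V_def e_def)
  ultimately have conv: "convergent V" and "e \<longlonglongrightarrow> 0"
    using summable_decrease[of V e "1 - 2 * c"] c by blast+
  have "(\<lambda>n. x (Suc (Suc n)) - x (Suc n)) \<longlonglongrightarrow> 0"
    by (rule power2_tendsto_0_imp_tendsto_0) (use \<open>e \<longlonglongrightarrow> 0\<close> in \<open>simp add: e_def[abs_def]\<close>)
  then show diff: "(\<lambda>n. x (Suc n) - x n) \<longlonglongrightarrow> 0"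
    by (rule LIMSEQ_imp_Suc)
  have "(\<lambda>n. c * (norm (x (Suc n) - x n))\<^sup>2) \<longlonglongrightarrow> c * (norm (0::'h))\<^sup>2"
    by (intro tendsto_intros diff)
  then have "convergent (\<lambda>n. V n - c * (norm (x (Suc n) - x n))\<^sup>2)"
    using conv by (intro convergent_diff) (auto intro: convergentI)
  then have "convergent (\<lambda>n. (norm (x (Suc n) - p))\<^sup>2)"
    by (simp add: V_def)
  then have "convergent (\<lambda>n. norm (x (Suc n) - p))"
    by (rule convergent_power2_norm_imp)
  then show "convergent (\<lambda>n. norm (x n - p))"
    by (simp add: convergent_Suc_iff[of "\<lambda>n. norm (x n - p)"])
qed


section \<open>The monotone Lipschitz case\<close>

lemma lipschitz_fejer:
  assumes small: "\<gamma> * \<mu> < sqrt 2 - 1" and p: "- B p \<in> A p"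
  shows "convergent (\<lambda>n. norm (x n - p))" and "(\<lambda>n. x (Suc n) - x n) \<longlonglongrightarrow> 0"
proof -
  define s where "s = \<gamma> * \<mu>"
  \<comment> \<open>Since \<open>(1 + sqrt 2) * (sqrt 2 - 1) = 1\<close>, positivity of \<kappa> is
    precisely the step-size bound.\<close>
  define \<kappa> where "\<kappa> = 1 - (1 + sqrt 2) * s"
  \<comment> \<open>The shift by two makes both ends of \<open>D n\<close> outputs of a resolvent
    step, as \<open>c_mono\<close> requires. Here \<open>c n\<close> belongs to
    \<open>x (Suc n)\<close>, the earlier end.\<close>
  define X where "X n = x (Suc (Suc n)) - p" for n
  define D where "D n = x (Suc (Suc n)) - x (Suc n)" for n
  define E where "E n = x (Suc (Suc n)) - y (Suc n)" for n
  define b where "b n = B (y (Suc n)) - B p" for n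
  define c where "c n = a n + B p" for n
  define V where "V n = (norm (X n))\<^sup>2 - 2 * (\<gamma> * inner (D n) (c n)) + s * (norm (E n))\<^sup>2" for n
  have sqrt2: "sqrt 2 * sqrt 2 = (2::real)" "1 < sqrt (2::real)" "sqrt 2 < (3/2::real)"
    using real_less_lsqrt[of "3/2" 2] by (simp_all add: power2_eq_square)
  have s: "0 < s" "s < 1 / 2" using pos small sqrt2 by (auto simp: s_def)
  have "(1 + sqrt 2) * s < (1 + sqrt 2) * (sqrt 2 - 1)"
    using small sqrt2 by (intro mult_strict_left_mono) (auto simp: s_def intro: add_pos_pos)
  then have \<kappa>: "\<kappa> > 0" using sqrt2 by (simp add: \<kappa>_def algebra_simps)
  have E_Suc: "E (Suc n) = D (Suc n) - D n" for n
    by (simp add: E_def D_def y_Suc scaleR_2)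
  have c_Suc: "\<gamma> *\<^sub>R c (Suc n) = - D n - \<gamma> *\<^sub>R b n" for n
    by (simp add: c_def scaleR_add_right scaleR_a D_def b_def scaleR_diff_right)
  \<comment> \<open>This makes \<open>inner (D n) (c n)\<close> telescope where the variational-inequality proof would use a
    subgradient inequality.\<close>
  have c_mono: "inner (D n) (c n) \<le> inner (D n) (c (Suc n))" for n
    using A_mono[OF a_mem[of "Suc n"] a_mem[of n]] by (simp add: D_def c_def inner_simps)
  have c_Suc_inner: "\<gamma> * inner u (c (Suc n)) = - inner u (D n) - \<gamma> * inner u (b n)" for u n
    using arg_cong[OF c_Suc, of "inner u"] by (simp add: inner_simps)
  have b_bound: "\<gamma> * norm (b n) \<le> s * (norm (E n) + norm (X n))" for n
  proof -
    have "norm (b n) \<le> \<mu> * norm (y (Suc n) - p)" unfolding b_def by (rule lip)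
    also have "y (Suc n) - p = X n - E n" by (simp add: X_def E_def)
    also have "norm (X n - E n) \<le> norm (E n) + norm (X n)"
      using norm_triangle_ineq4[of "X n" "E n"] by simp
    finally show ?thesis using pos by (simp add: s_def mult.assoc)
  qed
  have \<kappa>_mult: "\<kappa> * r = r - (1 + sqrt 2) * s * r" for r
    by (simp add: \<kappa>_def left_diff_distrib)
  have decr: "V (Suc n) \<le> V n - \<kappa> * (norm (D n))\<^sup>2" for n
  proof -
    \<comment> \<open>Monotonicity of \<open>B\<close> at \<open>y\<close> and \<open>p\<close>
      replaces \<open>X (Suc n)\<close> by the second difference \<open>E (Suc n)\<close> in the
      cross term.\<close>
    have "inner (y (Suc (Suc n)) - p) (b (Suc n)) \<ge> 0"
      using B by (simp add: b_def)
    moreover have "X (Suc n) = E (Suc n) + (y (Suc (Suc n)) - p)"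
      by (simp add: X_def E_def)
    ultimately have "inner (E (Suc n)) (b (Suc n)) \<le> inner (X (Suc n)) (b (Suc n))"
      by (simp add: inner_add_left)
    then have "\<gamma> * inner (E (Suc n)) (b (Suc n)) \<le> \<gamma> * inner (X (Suc n)) (b (Suc n))"
      using pos by simp
    then have 1: "(norm (X (Suc n)))\<^sup>2 \<le> (norm (X n))\<^sup>2 - (norm (D (Suc n)))\<^sup>2
        - 2 * (\<gamma> * inner (E (Suc n)) (b (Suc n)))"
      using step_inequality[OF p, of "Suc (Suc n)"] by (simp add: X_def D_def b_def)
    have 2: "\<gamma> * inner (D n) (c n) \<le> \<gamma> * inner (D n) (c (Suc n))"
      using c_mono pos by simp
    have "norm (b (Suc n) - b n) \<le> \<mu> * norm (D n + E n)"
    proof -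
      have "D n + E n = y (Suc (Suc n)) - y (Suc n)"
        by (simp add: D_def E_def y_Suc[of "Suc n"] scaleR_2)
      then show ?thesis
        using lip[of "y (Suc (Suc n))" "y (Suc n)"] by (simp add: b_def)
    qed
    then have "norm (E (Suc n)) * norm (b (Suc n) - b n)
        \<le> norm (E (Suc n)) * (\<mu> * norm (D n + E n))"
      by (intro mult_left_mono) auto
    then have "- inner (E (Suc n)) (b (Suc n) - b n) \<le> \<mu> * (norm (E (Suc n)) * norm (D n + E n))"
      using Cauchy_Schwarz_ineq2[of "E (Suc n)" "b (Suc n) - b n"] by (simp add: mult.left_commute)
    then have "\<gamma> * (- inner (E (Suc n)) (b (Suc n) - b n))
        \<le> \<gamma> * (\<mu> * (norm (E (Suc n)) * norm (D n + E n)))"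
      using pos by (intro mult_left_mono) auto
    then have 3: "- 2 * (\<gamma> * inner (E (Suc n)) (b (Suc n) - b n))
        \<le> s * (2 * (norm (E (Suc n)) * norm (D n + E n)))"
      by (simp add: s_def algebra_simps)
    \<comment> \<open>Two Young steps, with weights \<open>1 + sqrt 2\<close> here and
      \<open>sqrt 2\<close> below, are balanced so that \<open>D n\<close> and
      \<open>E (Suc n)\<close> get the same coefficient \<open>(1 + sqrt 2) * s\<close>, once
      \<open>s\<close> times the square of \<open>E\<close> is left to telescope in
      \<open>V\<close>.\<close>
    have "2 * (norm (D n) * norm (E n))
        \<le> (1 + sqrt 2) * (norm (D n))\<^sup>2 + (norm (E n))\<^sup>2 / (1 + sqrt 2)"
      using sqrt2 by (intro two_mult_le_weighted) linarith
    also have "(norm (E n))\<^sup>2 / (1 + sqrt 2) = (sqrt 2 - 1) * (norm (E n))\<^sup>2"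
    proof -
      have "(1 + sqrt 2) * (sqrt 2 - 1) = (1::real)" by (simp add: algebra_simps)
      moreover have "1 + sqrt 2 > (0::real)" by (simp add: add_pos_pos)
      ultimately have "1 / (1 + sqrt 2) = sqrt 2 - (1::real)"
        by (metis nonzero_mult_div_cancel_left less_irrefl)
      then show ?thesis by (metis mult.left_neutral times_divide_eq_left)
    qed
    finally have young: "2 * (norm (D n) * norm (E n))
        \<le> (1 + sqrt 2) * (norm (D n))\<^sup>2 + (sqrt 2 - 1) * (norm (E n))\<^sup>2" .
    have "2 * (norm (D n) * norm (E n)) + (norm (D n))\<^sup>2 + (norm (E n))\<^sup>2
        \<le> sqrt 2 * ((1 + sqrt 2) * (norm (D n))\<^sup>2 + (norm (E n))\<^sup>2)"
    proof -
      have sqrt2_cancel: "sqrt 2 * (sqrt 2 * r) = 2 * r" for r :: real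
        using sqrt2(1) by (simp flip: mult.assoc)
      with young show ?thesis by (simp add: algebra_simps sqrt2_cancel)
    qed
    moreover have "(norm (D n + E n))\<^sup>2 \<le> (norm (D n) + norm (E n))\<^sup>2"
      by (intro power_mono norm_triangle_ineq) simp
    ultimately have "(norm (D n + E n))\<^sup>2
        \<le> sqrt 2 * ((1 + sqrt 2) * (norm (D n))\<^sup>2 + (norm (E n))\<^sup>2)"
      by (simp add: power2_sum)
    then have "(norm (D n + E n))\<^sup>2 / sqrt 2 \<le> (1 + sqrt 2) * (norm (D n))\<^sup>2 + (norm (E n))\<^sup>2"
      by (simp add: pos_divide_le_eq mult.commute)
    moreover have "2 * (norm (E (Suc n)) * norm (D n + E n))
        \<le> sqrt 2 * (norm (E (Suc n)))\<^sup>2 + (norm (D n + E n))\<^sup>2 / sqrt 2"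
      by (intro two_mult_le_weighted) simp
    ultimately have "s * (2 * (norm (E (Suc n)) * norm (D n + E n)))
        \<le> s * (sqrt 2 * (norm (E (Suc n)))\<^sup>2 + (1 + sqrt 2) * (norm (D n))\<^sup>2 + (norm (E n))\<^sup>2)"
      using s by (intro mult_left_mono) auto
    with 3 have "- 2 * (\<gamma> * inner (E (Suc n)) (b (Suc n) - b n))
        \<le> s * (sqrt 2 * (norm (E (Suc n)))\<^sup>2 + (1 + sqrt 2) * (norm (D n))\<^sup>2 + (norm (E n))\<^sup>2)"
      by linarith
    moreover have "\<dots> = (1 + sqrt 2) * s * (norm (D n))\<^sup>2 + s * (norm (E n))\<^sup>2
        + (1 + sqrt 2) * s * (norm (E (Suc n)))\<^sup>2 - s * (norm (E (Suc n)))\<^sup>2"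
      by (simp add: algebra_simps)
    ultimately have 4: "- 2 * (\<gamma> * inner (E (Suc n)) (b (Suc n) - b n))
        \<le> (norm (D n))\<^sup>2 - \<kappa> * (norm (D n))\<^sup>2 + s * (norm (E n))\<^sup>2
        + (norm (E (Suc n)))\<^sup>2 - \<kappa> * (norm (E (Suc n)))\<^sup>2 - s * (norm (E (Suc n)))\<^sup>2"
      using \<kappa>_mult[of "(norm (D n))\<^sup>2"] \<kappa>_mult[of "(norm (E (Suc n)))\<^sup>2"] by linarith
    have 5: "2 * inner (E (Suc n)) (D n)
        = (norm (D (Suc n)))\<^sup>2 - (norm (D n))\<^sup>2 - (norm (E (Suc n)))\<^sup>2"
      unfolding E_Suc power2_norm_eq_inner by (simp add: inner_simps inner_commute)
    \<comment> \<open>\<open>c_Suc\<close> eliminates \<open>b n\<close>, and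
      \<open>E (Suc n) = D (Suc n) - D n\<close> splits the result into the inner product stored in
      \<open>V (Suc n)\<close> and one that fact 2 compares with that in \<open>V n\<close>.\<close>
    have 6: "\<gamma> * inner (E (Suc n)) (b (Suc n)) = \<gamma> * inner (E (Suc n)) (b (Suc n) - b n)
        - inner (E (Suc n)) (D n) - \<gamma> * inner (D (Suc n)) (c (Suc n)) + \<gamma> * inner (D n) (c (Suc n))"
      using c_Suc_inner[of "E (Suc n)" n] unfolding E_Suc
      by (simp add: inner_simps algebra_simps)
    have "0 \<le> \<kappa> * (norm (E (Suc n)))\<^sup>2" using \<kappa> by simp
    with 1 2 4 5 6 show ?thesis
      unfolding V_def by linarith
  qed
  have lower: "(norm (X n))\<^sup>2 / 2 \<le> V n" for n
  proof -
    define d e \<xi> where "d = norm (D n)" and "e = norm (E n)" and "\<xi> = norm (X n)"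
    have "\<gamma> * inner (D n) (c n) \<le> \<gamma> * inner (D n) (c (Suc n))"
      using c_mono pos by simp
    also have "\<dots> = - d\<^sup>2 - \<gamma> * inner (D n) (b n)"
      by (simp add: c_Suc_inner d_def power2_norm_eq_inner)
    finally have upper: "\<gamma> * inner (D n) (c n) \<le> - d\<^sup>2 - \<gamma> * inner (D n) (b n)" .
    have "- (\<gamma> * inner (D n) (b n)) \<le> d * (\<gamma> * norm (b n))"
    proof -
      have "\<gamma> * (- inner (D n) (b n)) \<le> \<gamma> * (d * norm (b n))"
        using Cauchy_Schwarz_ineq2[of "D n" "b n"] pos unfolding d_def
        by (intro mult_left_mono) auto
      then show ?thesis by (simp add: algebra_simps)
    qed
    also have "d * (\<gamma> * norm (b n)) \<le> d * (s * (e + \<xi>))"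
      using b_bound by (intro mult_left_mono) (auto simp: d_def e_def \<xi>_def)
    finally have 1: "\<gamma> * inner (D n) (c n) \<le> - d\<^sup>2 + d * (s * (e + \<xi>))"
      using upper by linarith
    \<comment> \<open>The gap in the estimate below is exactly the sum of these three terms;
      \<open>s < 1 / 2\<close> makes the last coefficient positive.\<close>
    have "0 \<le> s * (d - e)\<^sup>2" using s by simp
    moreover have "0 \<le> (2 * s * d - \<xi>)\<^sup>2 / 2" by simp
    moreover have "0 \<le> (2 - s - 2 * s\<^sup>2) * d\<^sup>2"
    proof -
      have "s * s \<le> 1 / 2 * (1 / 2)" using s by (intro mult_mono) auto
      with s show ?thesis by (simp add: power2_eq_square)
    qed
    ultimately have "\<xi>\<^sup>2 / 2 \<le> \<xi>\<^sup>2 - 2 * (- d\<^sup>2 + d * (s * (e + \<xi>))) + s * e\<^sup>2"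
      by (simp add: power2_eq_square field_simps)
    also have "\<dots> \<le> \<xi>\<^sup>2 - 2 * (\<gamma> * inner (D n) (c n)) + s * e\<^sup>2"
      using 1 by (intro add_right_mono diff_left_mono mult_left_mono) auto
    finally show ?thesis by (simp add: V_def \<xi>_def e_def)
  qed
  have nonneg: "0 \<le> V n" for n
    using lower[of n] zero_le_power2[of "norm (X n)"] by linarith
  have conv: "convergent V" and sq: "(\<lambda>n. (norm (D n))\<^sup>2) \<longlonglongrightarrow> 0"
    using summable_decrease[of V "\<lambda>n. (norm (D n))\<^sup>2" \<kappa>] nonneg \<kappa> decr by simp_all
  have D: "D \<longlonglongrightarrow> 0"
    using sq by (rule power2_tendsto_0_imp_tendsto_0)
  then show "(\<lambda>n. x (Suc n) - x n) \<longlonglongrightarrow> 0"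
    by (intro LIMSEQ_imp_Suc[of "\<lambda>n. x (Suc n) - x n"]) (simp add: D_def[abs_def])
  have "(\<lambda>n. E (Suc n)) \<longlonglongrightarrow> 0"
    unfolding E_Suc using tendsto_diff[OF LIMSEQ_Suc[OF D] D] by simp
  then have E: "E \<longlonglongrightarrow> 0" by (rule LIMSEQ_imp_Suc)
  obtain K where K: "\<And>n. norm (X n) \<le> K"
  proof -
    obtain M where "\<And>n. norm (V n) \<le> M"
      using convergent_imp_Bseq[OF conv] by (auto simp: Bseq_def)
    then have "(norm (X n))\<^sup>2 \<le> 2 * M" for n
      using lower[of n] by (smt (verit) field_sum_of_halves real_norm_def)
    then have "norm (X n) \<le> sqrt (2 * M)" for n
      by (simp add: real_le_rsqrt)
    then show ?thesis by (rule that)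
  qed
  \<comment> \<open>By \<open>c_Suc\<close>, \<open>\<gamma> *\<^sub>R c (Suc n)\<close> stays
    bounded while \<open>D\<close> vanishes. Hence \<open>V\<close> and the squared distance have
    the same limit.\<close>
  have "(\<lambda>n. \<gamma> * inner (D (Suc n)) (c (Suc n))) \<longlonglongrightarrow> 0"
  proof (rule Lim_null_comparison)
    let ?g = "\<lambda>n. norm (D (Suc n)) * (norm (D n) + s * (norm (E n) + K))"
    show "\<forall>\<^sub>F n in sequentially. norm (\<gamma> * inner (D (Suc n)) (c (Suc n))) \<le> ?g n"
    proof (rule always_eventually, rule allI)
      fix n
      have "norm (\<gamma> * inner (D (Suc n)) (c (Suc n))) = \<bar>inner (D (Suc n)) (\<gamma> *\<^sub>R c (Suc n))\<bar>"
        by simp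
      also have "\<dots> \<le> norm (D (Suc n)) * norm (\<gamma> *\<^sub>R c (Suc n))" by (rule Cauchy_Schwarz_ineq2)
      also have "norm (\<gamma> *\<^sub>R c (Suc n)) \<le> norm (D n) + norm (\<gamma> *\<^sub>R b n)"
        unfolding c_Suc using norm_triangle_ineq4[of "- D n" "\<gamma> *\<^sub>R b n"] by simp
      also have "norm (\<gamma> *\<^sub>R b n) = \<gamma> * norm (b n)" using pos by simp
      also have "\<dots> \<le> s * (norm (E n) + norm (X n))" by (rule b_bound)
      also have "\<dots> \<le> s * (norm (E n) + K)" using K s by simp
      finally show "norm (\<gamma> * inner (D (Suc n)) (c (Suc n))) \<le> ?g n"
        by (simp add: mult_left_mono)
    qed
    have "?g \<longlonglongrightarrow> norm (0::'h) * (norm (0::'h) + s * (norm (0::'h) + K))"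
      by (intro tendsto_intros D E LIMSEQ_Suc)
    then show "?g \<longlonglongrightarrow> 0" by simp
  qed
  then have "(\<lambda>n. \<gamma> * inner (D n) (c n)) \<longlonglongrightarrow> 0" by (rule LIMSEQ_imp_Suc)
  then have "(\<lambda>n. s * (norm (E n))\<^sup>2 - 2 * (\<gamma> * inner (D n) (c n))) \<longlonglongrightarrow> s * (norm (0::'h))\<^sup>2 - 2 * 0"
    by (intro tendsto_intros E)
  then have "convergent (\<lambda>n. V n - (s * (norm (E n))\<^sup>2 - 2 * (\<gamma> * inner (D n) (c n))))"
    by (rule convergent_diff[OF conv convergentI])
  then have "convergent (\<lambda>n. (norm (X n))\<^sup>2)"
    by (simp add: V_def)
  then have "convergent (\<lambda>n. norm (X n))"
    by (rule convergent_power2_norm_imp)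
  then show "convergent (\<lambda>n. norm (x n - p))"
    using convergent_Suc_iff[of "\<lambda>n. norm (x n - p)"] convergent_Suc_iff[of "\<lambda>n. norm (x (Suc n) - p)"]
    by (simp add: X_def)
qed

end

section \<open>Weak convergence in both regimes\<close>

theorem theorem2p1:
  fixes A :: "'h::{real_inner, complete_space} \<Rightarrow> 'h set"
    and B :: "'h \<Rightarrow> 'h"
    and \<mu> \<gamma> :: real
    and x y :: "nat \<Rightarrow> 'h"
    and x_minus1 :: 'h
  assumes "maximally_monotone A"
    and "\<mu> > 0"
    and "monotone_op (setop_of B)"
    and "\<mu>-lipschitz_on UNIV B"
    and "zer (setop_add A (setop_of B)) \<noteq> {}"
    and "\<gamma> \<in> {0<..}"
    and "\<And>n. y n = 2 *\<^sub>R x n - (case n of 0 \<Rightarrow> x_minus1 | Suc m \<Rightarrow> x m)"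
    and "\<And>n. resolvent (setop_scale \<gamma> A) (x n - \<gamma> *\<^sub>R B (y n)) = {x (Suc n)}"
  shows "((\<exists>\<beta>\<in>{0<..}. cocoercive \<beta> B \<and>
            (\<exists>\<epsilon>\<in>{0<..<1}. \<gamma> \<in> {0<..\<beta> * (1 - \<epsilon>) / 2})) \<longrightarrow>
          (\<exists>xbar\<in>zer (setop_add A (setop_of B)). weakly_converges x xbar))
       \<and> (\<gamma> \<in> {0<..<(sqrt 2 - 1) / \<mu>} \<longrightarrow>
          (\<exists>xbar\<in>zer (setop_add A (setop_of B)). weakly_converges x xbar))"
proof -
  have "reflected_forward_backward A B \<mu> \<gamma> x y"
  proof
    show "maximally_monotone A" "\<mu> > 0" "zer (setop_add A (setop_of B)) \<noteq> {}" "\<gamma> > 0"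
      using assms by auto
    show "inner (u - v) (B u - B v) \<ge> 0" for u v
      using assms(3) by (auto simp: monotone_op_def gra_def setop_of_def)
    show "norm (B u - B v) \<le> \<mu> * norm (u - v)" for u v
      using lipschitz_onD[OF assms(4), of u v] by (simp add: dist_norm)
    show "y (Suc n) = 2 *\<^sub>R x (Suc n) - x n" for n
      by (simp add: assms(7))
    show "(1 / \<gamma>) *\<^sub>R (x n - x (Suc n)) - B (y n) \<in> A (x (Suc n))" for n
    proof -
      have "x (Suc n) \<in> resolvent (setop_scale \<gamma> A) (x n - \<gamma> *\<^sub>R B (y n))"
        using assms(8) by simp
      then obtain u where u: "u \<in> A (x (Suc n))" "x n - \<gamma> *\<^sub>R B (y n) = x (Suc n) + \<gamma> *\<^sub>R u"
        by (auto simp: resolvent_def setop_inverse_def setop_add_def setop_of_def setop_scale_def)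
      then have "\<gamma> *\<^sub>R u = x n - x (Suc n) - \<gamma> *\<^sub>R B (y n)"
        by (simp add: algebra_simps)
      then have "(1 / \<gamma>) *\<^sub>R (\<gamma> *\<^sub>R u) = (1 / \<gamma>) *\<^sub>R (x n - x (Suc n) - \<gamma> *\<^sub>R B (y n))"
        by simp
      then have "u = (1 / \<gamma>) *\<^sub>R (x n - x (Suc n)) - B (y n)"
        using assms(6) by (simp add: scaleR_diff_right)
      with u show ?thesis by simp
    qed
  qed
  then interpret reflected_forward_backward A B \<mu> \<gamma> x y .
  \<comment> \<open>Both lemmas on the regimes derive the vanishing of increments from a given zero,
    so one is fixed here.\<close>
  obtain p where p: "- B p \<in> A p" using zer mem_zer_iff by blast
  show ?thesis
  proof (intro conjI impI)
    assume "\<exists>\<beta>\<in>{0<..}. cocoercive \<beta> B \<and> (\<exists>\<epsilon>\<in>{0<..<1}. \<gamma> \<in> {0<..\<beta> * (1 - \<epsilon>) / 2})"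
    then obtain \<beta> \<epsilon> where \<beta>: "\<beta> > 0" "cocoercive \<beta> B" and \<epsilon>: "\<epsilon> > 0" "\<gamma> \<le> \<beta> * (1 - \<epsilon>) / 2"
      by auto
    \<comment> \<open>Positivity of \<epsilon> makes the bound \<open>\<gamma> < \<beta> / 2\<close>
      strict.\<close>
    have "\<beta> * (1 - \<epsilon>) < \<beta> * 1" using \<beta> \<epsilon> by (intro mult_strict_left_mono) auto
    with \<epsilon> have "\<gamma> < \<beta> / 2" by linarith
    note fejer = cocoercive_fejer[OF \<beta> this]
    show "\<exists>xbar\<in>zer (setop_add A (setop_of B)). weakly_converges x xbar"
      by (rule weakly_convergent) (use fejer p in blast)+
  next
    assume "\<gamma> \<in> {0<..<(sqrt 2 - 1) / \<mu>}"
    then have "\<gamma> * \<mu> < sqrt 2 - 1" using assms(2) by (simp add: pos_less_divide_eq)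
    note fejer = lipschitz_fejer[OF this]
    show "\<exists>xbar\<in>zer (setop_add A (setop_of B)). weakly_converges x xbar"
      by (rule weakly_convergent) (use fejer p in blast)+
  qed
qed

end
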